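(* Identify $\mathcal{BG}$ (as a nonsymmetric operad) with the vector space $\mathcal{M}$ of nonempty forests through the bijection $\Psi$. Then the composition of $\mathcal{BG}$ in the basis of forests belonging to $\mathbb{F}\setminus\{1\}$ can be inductively defined in this way: for $H,H_1,H_2,\ldots\in\mathbb{F}\setminus\{1\}$, $$\bullet\circ(H)=H,$$ $$FG\circ(H_1,\dots,H_{|F|+|G|})=F\circ(H_1,\dots,H_{|F|})\;G\circ(H_{|F|+1},\dots,H_{|F|+|G|}),$$ $$B(F\otimes G)\circ(H_1,\dots,H_{|F|+|G|+1})=\big((F\circ(H_1,\dots,H_{|F|}))\succ H_{|F|+1}\big)\prec\big(G\circ(H_{|F|+2},\dots,H_{|F|+|G|+1})\big).$$ Here $F,G$ are nonempty forests of $\mathbb{F}$ in the second formula and arbitrary forests of $\mathbb{F}$ in the third, with the conventions $1\circ()=1$, $1\succ x=x$ and $x\prec 1=x$ for the empty forest $1$ and $x\in\mathcal{M}$.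
   Context: $\mathbb{K}$ is a commutative field of any characteristic. A bigraft algebra ($\mathcal{BG}$-algebra) is a $\mathbb{K}$-vector space $A$ with three linear maps $\ast,\succ,\prec:A\otimes A\to A$ such that for all $x,y,z\in A$: $(x\ast y)\ast z=x\ast(y\ast z)$, $(x\ast y)\succ z=x\succ(y\succ z)$, $(x\succ y)\ast z=x\succ(y\ast z)$, $(x\prec y)\prec z=x\prec(y\ast z)$, $(x\ast y)\prec z=x\ast(y\prec z)$, $(x\succ y)\prec z=x\succ(y\prec z)$ (no unit assumed). The operad $\mathcal{BG}$ is regular; we work with the associated nonsymmetric operad $\widetilde{\mathcal{BG}}$, with the same generators (three binary operations) and relations. We consider planar rooted forests (finite ordered sequences of planar rooted trees) whose edges are decorated by $l$ or $r$; $|F|$ is the number of vertices of $F$, $1$ is the empty forest and $\bullet$ the tree with one vertex. For two such forests $F,G$, $B(F\otimes G)$ is the tree obtained by grafting the roots of the trees of $F$ followed by those of $G$ (in this left-to-right order) on a common new root, the edges from the new root to the roots of $F$ being decorated by $l$ and those to the roots of $G$ by $r$. Let $\mathbb{T}$ be the set consisting of $1$ and of the trees obtained inductively as $B(F_1\cdots F_p\otimes G_1\cdots G_q)$, $p,q\ge 0$, with all $F_i,G_j$ nonempty trees already in $\mathbb{T}$; $\mathbb{F}$ is the set of forests all of whose trees are in $\mathbb{T}$ (including $1$). $\mathcal{M}$ is the vector space with basis $\mathbb{F}\setminus\{1\}$; it is a $\mathcal{BG}$-algebra for concatenation and the operations defined, for $F=F_1\cdots F_n$, $G=G_1\cdots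 G_k$ in $\mathbb{F}\setminus\{1\}$ (the $F_i,G_j$ nonempty trees) with $F_1=B(F_1^1\otimes F_1^2)$, $G_k=B(G_k^1\otimes G_k^2)$, by $G\succ F=B(GF_1^1\otimes F_1^2)F_2\cdots F_n$ and $G\prec F=G_1\cdots G_{k-1}B(G_k^1\otimes G_k^2F)$. The map $\Psi:\widetilde{\mathcal{BG}}(n)\to\mathrm{Vect}(\text{forests of }\mathbb{F}\text{ of degree }n)$, $p\mapsto p.(\bullet,\dots,\bullet)$ (action of $p$ on the $\mathcal{BG}$-algebra $\mathcal{M}$), is bijective for every $n\ge1$; the forest $F$ is identified with $\Psi^{-1}(F)$, and $F\circ(H_1,\dots,H_{|F|})$ denotes operadic composition. *)

theory Defs
  imports Complex_Main "HOL-Library.Poly_Mapping"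
begin

text \<open>The vector space with basis \<open>'b\<close> over \<open>'k\<close> is the type \<open>'b \<Rightarrow>\<^sub>0 'k\<close> of finitely supported
  functions.\<close>

definition pm_scale :: "'k::field \<Rightarrow> ('b \<Rightarrow>\<^sub>0 'k) \<Rightarrow> ('b \<Rightarrow>\<^sub>0 'k)" where
  "pm_scale c p = Poly_Mapping.map ((*) c) p"

abbreviation bvec :: "'b \<Rightarrow> ('b \<Rightarrow>\<^sub>0 'k::field)" where
  "bvec b \<equiv> Poly_Mapping.single b 1"

definition lin_ext ::
  "('k::field \<Rightarrow> 'a::ab_group_add \<Rightarrow> 'a) \<Rightarrow> ('b \<Rightarrow> 'a) \<Rightarrow> ('b \<Rightarrow>\<^sub>0 'k) \<Rightarrow> 'a" where
  "lin_ext scale f p = (\<Sum>b\<in>Poly_Mapping.keys p. scale (Poly_Mapping.lookup p b) (f b))"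

definition bilin_ext ::
  "('b \<Rightarrow> 'c \<Rightarrow> 'd) \<Rightarrow> ('b \<Rightarrow>\<^sub>0 'k::field) \<Rightarrow> ('c \<Rightarrow>\<^sub>0 'k) \<Rightarrow> ('d \<Rightarrow>\<^sub>0 'k)" where
  "bilin_ext f p q =
     lin_ext pm_scale (\<lambda>b. lin_ext pm_scale (\<lambda>c. bvec (f b c)) q) p"

datatype gen = Ast | Succ | Prec

locale bigraft_algebra = vector_space scale
  for scale :: "'k::field \<Rightarrow> 'a::ab_group_add \<Rightarrow> 'a" +
  fixes A :: "'a set"
    and opr :: "gen \<Rightarrow> 'a \<Rightarrow> 'a \<Rightarrow> 'a"
  assumes subspace_A: "subspace A"
    and closed: "\<lbrakk>x \<in> A; y \<in> A\<rbrakk> \<Longrightarrow> opr g x y \<in> A"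
    and add_left: "\<lbrakk>x \<in> A; y \<in> A; z \<in> A\<rbrakk> \<Longrightarrow> opr g (x + y) z = opr g x z + opr g y z"
    and add_right: "\<lbrakk>x \<in> A; y \<in> A; z \<in> A\<rbrakk> \<Longrightarrow> opr g x (y + z) = opr g x y + opr g x z"
    and scale_left: "\<lbrakk>x \<in> A; y \<in> A\<rbrakk> \<Longrightarrow> opr g (scale c x) y = scale c (opr g x y)"
    and scale_right: "\<lbrakk>x \<in> A; y \<in> A\<rbrakk> \<Longrightarrow> opr g x (scale c y) = scale c (opr g x y)"
    and ast_ast: "\<lbrakk>x \<in> A; y \<in> A; z \<in> A\<rbrakk> \<Longrightarrow>
      opr Ast (opr Ast x y) z = opr Ast x (opr Ast y z)"
    and ast_succ: "\<lbrakk>x \<in> A; y \<in> A; z \<in> A\<rbrakk> \<Longrightarrow>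
      opr Succ (opr Ast x y) z = opr Succ x (opr Succ y z)"
    and succ_ast: "\<lbrakk>x \<in> A; y \<in> A; z \<in> A\<rbrakk> \<Longrightarrow>
      opr Ast (opr Succ x y) z = opr Succ x (opr Ast y z)"
    and prec_prec: "\<lbrakk>x \<in> A; y \<in> A; z \<in> A\<rbrakk> \<Longrightarrow>
      opr Prec (opr Prec x y) z = opr Prec x (opr Ast y z)"
    and ast_prec: "\<lbrakk>x \<in> A; y \<in> A; z \<in> A\<rbrakk> \<Longrightarrow>
      opr Prec (opr Ast x y) z = opr Ast x (opr Prec y z)"
    and succ_prec: "\<lbrakk>x \<in> A; y \<in> A; z \<in> A\<rbrakk> \<Longrightarrow>
      opr Prec (opr Succ x y) z = opr Succ x (opr Prec y z)"

text \<open>The free nonsymmetric operad on three binary generators has as basis in arity \<open>n\<close> the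
  planar binary trees with \<open>n\<close> leaves and with inner vertices labelled by the generators.\<close>

datatype bterm = Leaf | Op gen bterm bterm

fun leaves :: "bterm \<Rightarrow> nat" where
  "leaves Leaf = 1"
| "leaves (Op g s t) = leaves s + leaves t"

definition free_op :: "nat \<Rightarrow> (bterm \<Rightarrow>\<^sub>0 'k::field) set" where
  "free_op n = {p. \<forall>t\<in>Poly_Mapping.keys p. leaves t = n}"

text \<open>\<open>eval opr t xs\<close> is meant for \<open>length xs = leaves t\<close>.\<close>

fun eval :: "(gen \<Rightarrow> 'a \<Rightarrow> 'a \<Rightarrow> 'a) \<Rightarrow> bterm \<Rightarrow> 'a list \<Rightarrow> 'a" where
  "eval opr Leaf xs = hd xs"
| "eval opr (Op g s t) xs =
     opr g (eval opr s (take (leaves s) xs)) (eval opr t (drop (leaves s) xs))"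

definition free_act ::
  "('k::field \<Rightarrow> 'a::ab_group_add \<Rightarrow> 'a) \<Rightarrow> (gen \<Rightarrow> 'a \<Rightarrow> 'a \<Rightarrow> 'a) \<Rightarrow>
     (bterm \<Rightarrow>\<^sub>0 'k) \<Rightarrow> 'a list \<Rightarrow> 'a" where
  "free_act scale opr p xs = lin_ext scale (\<lambda>t. eval opr t xs) p"

text \<open>The composition of the free operad is the action on the free algebra on one generator;
  on basis elements it grafts trees on leaves, see \<open>free_comp_bvec\<close> below.\<close>

definition free_comp ::
  "(bterm \<Rightarrow>\<^sub>0 'k::field) \<Rightarrow> (bterm \<Rightarrow>\<^sub>0 'k) list \<Rightarrow> (bterm \<Rightarrow>\<^sub>0 'k)" where
  "free_comp = free_act pm_scale (\<lambda>g. bilin_ext (Op g))"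

text \<open>\<open>relator g h g' h'\<close> stands for the relation \<open>(x g y) h z = x g' (y h' z)\<close>.\<close>

definition relator :: "gen \<Rightarrow> gen \<Rightarrow> gen \<Rightarrow> gen \<Rightarrow> (bterm \<Rightarrow>\<^sub>0 'k::field)" where
  "relator g h g' h' =
     bvec (Op h (Op g Leaf Leaf) Leaf) - bvec (Op g' Leaf (Op h' Leaf Leaf))"

definition relators :: "(bterm \<Rightarrow>\<^sub>0 'k::field) set" where
  "relators =
    {relator Ast Ast Ast Ast, relator Ast Succ Succ Succ, relator Succ Ast Succ Ast,
     relator Prec Prec Prec Ast, relator Ast Prec Ast Prec, relator Succ Prec Succ Prec}"

inductive bg_ideal :: "nat \<Rightarrow> (bterm \<Rightarrow>\<^sub>0 'k::field) \<Rightarrow> bool" where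
  ideal_rel: "p \<in> relators \<Longrightarrow> bg_ideal 3 p"
| ideal_zero: "bg_ideal n 0"
| ideal_add: "bg_ideal n p \<Longrightarrow> bg_ideal n q \<Longrightarrow> bg_ideal n (p + q)"
| ideal_scale: "bg_ideal n p \<Longrightarrow> bg_ideal n (pm_scale c p)"
| ideal_comp_left:
    "bg_ideal (length qs) p \<Longrightarrow> list_all2 (\<lambda>q m. q \<in> free_op m) qs ms \<Longrightarrow>
       bg_ideal (sum_list ms) (free_comp p qs)"
| ideal_comp_right:
    "p \<in> free_op (length qs) \<Longrightarrow> list_all2 (\<lambda>q m. q \<in> free_op m) qs ms \<Longrightarrow>
       j < length qs \<Longrightarrow> bg_ideal (ms ! j) (qs ! j) \<Longrightarrow>
       bg_ideal (sum_list ms) (free_comp p qs)"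

definition bg_rel :: "nat \<Rightarrow> ((bterm \<Rightarrow>\<^sub>0 'k::field) \<times> (bterm \<Rightarrow>\<^sub>0 'k)) set" where
  "bg_rel n = {(p, q). p \<in> free_op n \<and> q \<in> free_op n \<and> bg_ideal n (p - q)}"

type_synonym 'k bg = "(bterm \<Rightarrow>\<^sub>0 'k) set"

definition BG :: "nat \<Rightarrow> 'k::field bg set" where
  "BG n = free_op n // bg_rel n"

text \<open>The list \<open>ms = [m\<^sub>1, \<dots>, m\<^sub>n]\<close> contains the arities of \<open>Qs\<close>; it is needed since the arity of
  the result \<open>BG (m\<^sub>1 + \<dots> + m\<^sub>n)\<close> cannot be read off from \<open>P\<close> and \<open>Qs\<close>. That composition and
  action do not depend on the representatives is shown in \<open>bg_comp_class\<close> and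
  \<open>bigraft_algebra.bg_act_class\<close>.\<close>

definition bg_comp :: "nat list \<Rightarrow> 'k::field bg \<Rightarrow> 'k bg list \<Rightarrow> 'k bg" where
  "bg_comp ms P Qs =
     (\<Union>p\<in>P. \<Union>qs\<in>listset Qs. bg_rel (sum_list ms) `` {free_comp p qs})"

definition bg_act ::
  "('k::field \<Rightarrow> 'a::ab_group_add \<Rightarrow> 'a) \<Rightarrow> (gen \<Rightarrow> 'a \<Rightarrow> 'a \<Rightarrow> 'a) \<Rightarrow>
     'k bg \<Rightarrow> 'a list \<Rightarrow> 'a" where
  "bg_act scale opr P xs = the_elem ((\<lambda>p. free_act scale opr p xs) ` P)"

text \<open>At each vertex of a tree in \<open>\<bbbT>\<close> the edges decorated by \<open>l\<close> precede those decorated by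
  \<open>r\<close>. Such a tree is thus the same as \<open>B F G\<close> for unique forests \<open>F\<close> (grafted with \<open>l\<close>-edges)
  and \<open>G\<close> (grafted with \<open>r\<close>-edges), so that \<open>\<bbbT>\<close> without the empty tree is a free datatype;
  \<open>bij_betw_decorate\<close> relates it to edge-decorated planar trees.\<close>

datatype tree = B "tree list" "tree list"

datatype decoration = L | R

datatype decorated_tree = Node "(decoration \<times> decorated_tree) list"

inductive_set decorated_T :: "decorated_tree set" where
  "F \<in> lists decorated_T \<Longrightarrow> G \<in> lists decorated_T \<Longrightarrow>
     Node (map (Pair L) F @ map (Pair R) G) \<in> decorated_T"

fun decorate :: "tree \<Rightarrow> decorated_tree" where
  "decorate (B F G) = Node (map (\<lambda>t. (L, decorate t)) F @ map (\<lambda>t. (R, decorate t)) G)"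

type_synonym forest = "tree list"

fun vertices :: "tree \<Rightarrow> nat" where
  "vertices (B F G) = Suc (sum_list (map vertices F) + sum_list (map vertices G))"

definition degree :: "forest \<Rightarrow> nat" where
  "degree F = sum_list (map vertices F)"

abbreviation dot :: tree where
  "dot \<equiv> B [] []"

text \<open>The operations extend those on nonempty forests by \<open>1 \<succ> F = F\<close> and \<open>G \<prec> 1 = G\<close>, where
  \<open>1 = []\<close>; see also \<open>M_conventions\<close>. The values of \<open>G \<succ> 1\<close> for \<open>G \<noteq> 1\<close> and of \<open>1 \<prec> F\<close> for
  \<open>F \<noteq> 1\<close> are irrelevant. The type \<open>forest \<Rightarrow>\<^sub>0 'k\<close> contains \<open>1\<close> as a basis element; the bigraft algebra
  is its subspace \<open>M_space\<close> without \<open>1\<close>, see the interpretation \<open>M\<close>.\<close>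

fun forest_succ :: "forest \<Rightarrow> forest \<Rightarrow> forest" where
  "forest_succ G (B F1 F2 # Fs) = B (G @ F1) F2 # Fs"
| "forest_succ G [] = []"

definition forest_prec :: "forest \<Rightarrow> forest \<Rightarrow> forest" where
  "forest_prec G F =
     (if G = [] then [] else butlast G @ [case last G of B G1 G2 \<Rightarrow> B G1 (G2 @ F)])"

fun forest_opr :: "gen \<Rightarrow> forest \<Rightarrow> forest \<Rightarrow> forest" where
  "forest_opr Ast G F = G @ F"
| "forest_opr Succ G F = forest_succ G F"
| "forest_opr Prec G F = forest_prec G F"

definition M_opr ::
  "gen \<Rightarrow> (forest \<Rightarrow>\<^sub>0 'k::field) \<Rightarrow> (forest \<Rightarrow>\<^sub>0 'k) \<Rightarrow> (forest \<Rightarrow>\<^sub>0 'k)" where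
  "M_opr g = bilin_ext (forest_opr g)"

abbreviation M_ast (infixl "\<star>" 70) where "x \<star> y \<equiv> M_opr Ast x y"
abbreviation M_succ (infixl "\<succ>" 70) where "x \<succ> y \<equiv> M_opr Succ x y"
abbreviation M_prec (infixl "\<prec>" 70) where "x \<prec> y \<equiv> M_opr Prec x y"

definition M_space :: "(forest \<Rightarrow>\<^sub>0 'k::field) set" where
  "M_space = {v. [] \<notin> Poly_Mapping.keys v}"

definition M_degree :: "nat \<Rightarrow> (forest \<Rightarrow>\<^sub>0 'k::field) set" where
  "M_degree n = {v \<in> M_space. \<forall>F\<in>Poly_Mapping.keys v. degree F = n}"

definition Psi :: "nat \<Rightarrow> 'k::field bg \<Rightarrow> (forest \<Rightarrow>\<^sub>0 'k)" where
  "Psi n P = bg_act pm_scale M_opr P (replicate n (bvec [dot]))"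

text \<open>The inverse is justified by \<open>bij_betw_Psi\<close> below.\<close>

definition bg_of_forest :: "forest \<Rightarrow> 'k::field bg" where
  "bg_of_forest F = inv_into (BG (degree F)) (Psi (degree F)) (bvec F)"

text \<open>For \<open>F = 1\<close>, which is not an element of the operad, this is the convention
  \<open>1 \<circ> () = 1\<close>.\<close>

definition forest_comp :: "forest \<Rightarrow> forest list \<Rightarrow> (forest \<Rightarrow>\<^sub>0 'k::field)" where
  "forest_comp F Hs =
     (if F = [] then bvec []
      else Psi (sum_list (map degree Hs))
             (bg_comp (map degree Hs) (bg_of_forest F) (map bg_of_forest Hs)))"


lemma lookup_pm_scale [simp]: "Poly_Mapping.lookup (pm_scale c p) b = c * Poly_Mapping.lookup p b"
  by (simp add: pm_scale_def map.rep_eq when_def)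

interpretation pm: vector_space pm_scale
  by unfold_locales (auto intro!: poly_mapping_eqI simp: lookup_add algebra_simps)

lemma keys_pm_scale: "Poly_Mapping.keys (pm_scale c p) \<subseteq> Poly_Mapping.keys p"
  by (auto simp: in_keys_iff)

context vector_space
begin

lemma lin_ext_superset:
  assumes "finite S" "Poly_Mapping.keys p \<subseteq> S"
  shows "lin_ext scale f p = (\<Sum>b\<in>S. scale (Poly_Mapping.lookup p b) (f b))"
  unfolding lin_ext_def using assms
  by (intro sum.mono_neutral_left) (auto simp: in_keys_iff)

lemma lin_ext_add: "lin_ext scale f (p + q) = lin_ext scale f p + lin_ext scale f q"
proof -
  let ?S = "Poly_Mapping.keys p \<union> Poly_Mapping.keys q"
  have "Poly_Mapping.keys (p + q) \<subseteq> ?S" by (rule keys_add)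
  then show ?thesis
    by (simp add: lin_ext_superset[of ?S] lookup_add scale_left_distrib sum.distrib)
qed

lemma lin_ext_scale: "lin_ext scale f (pm_scale c p) = scale c (lin_ext scale f p)"
  using lin_ext_superset[of "Poly_Mapping.keys p" "pm_scale c p"] keys_pm_scale[of c p]
  by (simp add: lin_ext_def scale_sum_right)

lemma lin_ext_bvec [simp]: "lin_ext scale f (bvec b) = f b"
  by (simp add: lin_ext_def)

lemma lin_ext_zero [simp]: "lin_ext scale f 0 = 0"
  by (simp add: lin_ext_def)

lemma lin_ext_uminus: "lin_ext scale f (- p) = - lin_ext scale f p"
  using lin_ext_add[of f p "- p"] by (simp add: eq_neg_iff_add_eq_0 add.commute)

lemma lin_ext_diff: "lin_ext scale f (p - q) = lin_ext scale f p - lin_ext scale f q"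
  using lin_ext_add[of f p "- q"] lin_ext_uminus by simp

lemma lin_ext_sum: "lin_ext scale f (\<Sum>i\<in>I. p i) = (\<Sum>i\<in>I. lin_ext scale f (p i))"
  by (induction I rule: infinite_finite_induct) (simp_all add: lin_ext_add)

lemma lin_ext_fun_add:
  "lin_ext scale (\<lambda>b. f b + g b) p = lin_ext scale f p + lin_ext scale g p"
  by (simp add: lin_ext_def scale_right_distrib sum.distrib)

lemma lin_ext_fun_scale:
  "lin_ext scale (\<lambda>b. scale c (f b)) p = scale c (lin_ext scale f p)"
  by (simp add: lin_ext_def scale_sum_right mult.commute)

lemma lin_ext_cong:
  "(\<And>b. b \<in> Poly_Mapping.keys p \<Longrightarrow> f b = g b) \<Longrightarrow> lin_ext scale f p = lin_ext scale g p"
  by (simp add: lin_ext_def)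

lemma lin_ext_mem:
  "subspace V \<Longrightarrow> (\<And>b. b \<in> Poly_Mapping.keys p \<Longrightarrow> f b \<in> V) \<Longrightarrow> lin_ext scale f p \<in> V"
  by (auto simp: lin_ext_def intro!: subspace_sum subspace_scale)

lemma lin_ext_lin_ext:
  "lin_ext scale f (lin_ext pm_scale g p) = lin_ext scale (\<lambda>b. lin_ext scale f (g b)) p"
proof -
  have "lin_ext scale f (lin_ext pm_scale g p) =
      (\<Sum>b\<in>Poly_Mapping.keys p. lin_ext scale f (pm_scale (Poly_Mapping.lookup p b) (g b)))"
    unfolding lin_ext_def[of pm_scale] by (rule lin_ext_sum)
  also have "\<dots> = lin_ext scale (\<lambda>b. lin_ext scale f (g b)) p"
    by (simp add: lin_ext_scale lin_ext_def[of scale _ p])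
  finally show ?thesis .
qed

end

lemma lin_ext_bvec_id: "lin_ext pm_scale bvec p = p"
proof (rule poly_mapping_eqI)
  fix k
  have "Poly_Mapping.lookup (lin_ext pm_scale bvec p) k =
    (\<Sum>b\<in>Poly_Mapping.keys p. Poly_Mapping.lookup p b * (1 when b = k))"
    by (simp add: lin_ext_def lookup_sum lookup_single)
  also have "\<dots> = (\<Sum>b\<in>Poly_Mapping.keys p. if b = k then Poly_Mapping.lookup p b else 0)"
    by (intro sum.cong) (auto simp: when_def)
  also have "\<dots> = Poly_Mapping.lookup p k"
    by (simp add: sum.delta not_in_keys_iff_lookup_eq_zero)
  finally show "Poly_Mapping.lookup (lin_ext pm_scale bvec p) k = Poly_Mapping.lookup p k" .
qed

lemma bilin_ext_add_left: "bilin_ext f (p + p') q = bilin_ext f p q + bilin_ext f p' q"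
  by (simp add: bilin_ext_def pm.lin_ext_add)

lemma bilin_ext_add_right: "bilin_ext f p (q + q') = bilin_ext f p q + bilin_ext f p q'"
  by (simp add: bilin_ext_def pm.lin_ext_add pm.lin_ext_fun_add)

lemma bilin_ext_scale_left: "bilin_ext f (pm_scale c p) q = pm_scale c (bilin_ext f p q)"
  unfolding bilin_ext_def by (rule pm.lin_ext_scale)

lemma bilin_ext_scale_right: "bilin_ext f p (pm_scale c q) = pm_scale c (bilin_ext f p q)"
  unfolding bilin_ext_def pm.lin_ext_scale by (rule pm.lin_ext_fun_scale)

lemma bilin_ext_bvec [simp]: "bilin_ext f (bvec a) (bvec b) = bvec (f a b)"
  by (simp add: bilin_ext_def)

lemma bilin_ext_diff_left: "bilin_ext f (p - p') q = bilin_ext f p q - bilin_ext f p' q"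
  by (simp add: bilin_ext_def pm.lin_ext_diff)

lemma bilin_ext_diff_right: "bilin_ext f p (q - q') = bilin_ext f p q - bilin_ext f p q'"
  using bilin_ext_add_right[of f p "q - q'" q'] by (simp add: algebra_simps)

lemma keys_lin_ext:
  "Poly_Mapping.keys (lin_ext pm_scale f p) \<subseteq>
     (\<Union>b\<in>Poly_Mapping.keys p. Poly_Mapping.keys (f b))"
proof -
  have "Poly_Mapping.keys (lin_ext pm_scale f p) \<subseteq>
     (\<Union>b\<in>Poly_Mapping.keys p. Poly_Mapping.keys (pm_scale (Poly_Mapping.lookup p b) (f b)))"
    unfolding lin_ext_def by (rule keys_sum)
  also have "\<dots> \<subseteq> (\<Union>b\<in>Poly_Mapping.keys p. Poly_Mapping.keys (f b))"
    by (intro UN_mono keys_pm_scale order_refl)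
  finally show ?thesis .
qed

lemma keys_bilin_ext:
  "Poly_Mapping.keys (bilin_ext f p q) \<subseteq>
     {f a b | a b. a \<in> Poly_Mapping.keys p \<and> b \<in> Poly_Mapping.keys q}"
proof
  fix k assume "k \<in> Poly_Mapping.keys (bilin_ext f p q)"
  from subsetD[OF keys_lin_ext this[unfolded bilin_ext_def]]
  obtain a where a: "a \<in> Poly_Mapping.keys p"
    "k \<in> Poly_Mapping.keys (lin_ext pm_scale (\<lambda>c. bvec (f a c)) q)" by auto
  from subsetD[OF keys_lin_ext a(2)]
  obtain b where "b \<in> Poly_Mapping.keys q" "k \<in> Poly_Mapping.keys (bvec (f a b) :: _ \<Rightarrow>\<^sub>0 'b)"
    by auto
  with a show "k \<in> {f a b | a b. a \<in> Poly_Mapping.keys p \<and> b \<in> Poly_Mapping.keys q}"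
    by auto
qed

text \<open>Identities between iterated bilinear extensions may be checked on basis elements.\<close>

lemma bilin_ext_assoc:
  assumes "\<And>a b c. a \<in> Poly_Mapping.keys p \<Longrightarrow> b \<in> Poly_Mapping.keys q \<Longrightarrow>
      c \<in> Poly_Mapping.keys r \<Longrightarrow> h (g a b) c = g' a (h' b c)"
  shows "bilin_ext h (bilin_ext g p q) r = bilin_ext g' p (bilin_ext h' q r)"
  unfolding bilin_ext_def pm.lin_ext_lin_ext using assms
  by (auto intro!: pm.lin_ext_cong)

lemma subspace_M_space: "pm.subspace (M_space :: (forest \<Rightarrow>\<^sub>0 'k::field) set)"
  unfolding pm.subspace_def M_space_def by (auto simp: in_keys_iff lookup_add)

lemma forest_opr_Nil_iff: "G \<noteq> [] \<Longrightarrow> F \<noteq> [] \<Longrightarrow> forest_opr g G F \<noteq> []"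
  by (cases g; cases F rule: list.exhaust; cases "hd F") (auto simp: forest_prec_def)

lemma forest_prec_snoc [simp]: "forest_prec (Gs @ [B G1 G2]) F = Gs @ [B G1 (G2 @ F)]"
  by (simp add: forest_prec_def)

lemma forest_prec_append: "F \<noteq> [] \<Longrightarrow> forest_prec (G @ F) H = G @ forest_prec F H"
  by (simp add: forest_prec_def butlast_append)

lemma forest_prec_prec: "forest_prec (forest_prec F G) H = forest_prec F (G @ H)"
  by (auto simp: forest_prec_def split: tree.split)

lemma forest_succ_append: "F \<noteq> [] \<Longrightarrow> forest_succ G (F @ H) = forest_succ G F @ H"
  by (cases F rule: list.exhaust; cases "hd F") auto

lemma forest_succ_succ: "forest_succ (G @ H) F = forest_succ G (forest_succ H F)"
  by (cases F rule: list.exhaust; cases "hd F") auto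

lemma forest_succ_prec:
  "F \<noteq> [] \<Longrightarrow> forest_prec (forest_succ G F) H = forest_succ G (forest_prec F H)"
  by (cases F rule: list.exhaust; cases "hd F"; cases "tl F")
     (auto simp: forest_prec_def split: tree.split)

lemma M_opr_closed: "x \<in> M_space \<Longrightarrow> y \<in> M_space \<Longrightarrow> M_opr g x y \<in> M_space"
  using keys_bilin_ext[of "forest_opr g" x y] forest_opr_Nil_iff
  by (simp add: M_space_def M_opr_def subset_iff) metis

lemma M_opr_assoc:
  assumes "x \<in> M_space" "y \<in> M_space" "z \<in> M_space"
    and "\<And>F G H. F \<noteq> [] \<Longrightarrow> G \<noteq> [] \<Longrightarrow> H \<noteq> [] \<Longrightarrow>
      forest_opr h (forest_opr g F G) H = forest_opr g' F (forest_opr h' G H)"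
  shows "M_opr h (M_opr g x y) z = M_opr g' x (M_opr h' y z)"
  unfolding M_opr_def
proof (rule bilin_ext_assoc)
  fix F G H
  assume "F \<in> Poly_Mapping.keys x" "G \<in> Poly_Mapping.keys y" "H \<in> Poly_Mapping.keys z"
  with assms(1-3) have "F \<noteq> []" "G \<noteq> []" "H \<noteq> []" by (auto simp: M_space_def)
  then show "forest_opr h (forest_opr g F G) H = forest_opr g' F (forest_opr h' G H)"
    by (rule assms(4))
qed

global_interpretation M: bigraft_algebra pm_scale M_space M_opr
  by (unfold_locales;
      (rule subspace_M_space | (simp only: M_opr_closed; fail)
        | (simp only: M_opr_def bilin_ext_add_left bilin_ext_add_right
            bilin_ext_scale_left bilin_ext_scale_right; fail)
        | (rule M_opr_assoc, assumption+, simp add: forest_prec_append forest_prec_prec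
            forest_succ_append forest_succ_succ forest_succ_prec)))

lemma M_conventions: "bvec [] \<succ> x = x" "x \<prec> bvec [] = x"
proof -
  have "forest_succ [] F = F" for F
    by (cases F rule: list.exhaust; cases "hd F") auto
  moreover have "forest_prec F [] = F" for F
    by (cases F rule: rev_exhaust; cases "last F") (auto simp: forest_prec_def)
  ultimately have "lin_ext pm_scale (\<lambda>F. bvec (forest_succ [] F)) x = lin_ext pm_scale bvec x"
    "lin_ext pm_scale (\<lambda>F. bvec (forest_prec F [])) x = lin_ext pm_scale bvec x"
    by (auto intro!: pm.lin_ext_cong)
  then show "bvec [] \<succ> x = x" "x \<prec> bvec [] = x"
    by (simp_all add: M_opr_def bilin_ext_def lin_ext_bvec_id)
qed

lemma inj_decorate: "inj decorate"
proof (rule injI)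
  fix t t' assume "decorate t = decorate t'"
  then show "t = t'"
  proof (induction t arbitrary: t')
    case (B F G)
    obtain F' G' where t': "t' = B F' G'" by (cases t')
    let ?l = "map (\<lambda>t. (L, decorate t))" and ?r = "map (\<lambda>t. (R, decorate t))"
    have eq: "?l F @ ?r G = ?l F' @ ?r G'" using B.prems by (simp add: t')
    have "?l F = ?l F'" "?r G = ?r G'"
      using arg_cong[OF eq, of "filter (\<lambda>x. fst x = L)"]
        arg_cong[OF eq, of "filter (\<lambda>x. fst x = R)"]
      by (simp_all add: filter_map comp_def)
    then have "list_all2 (\<lambda>t t'. decorate t = decorate t') F F'"
      "list_all2 (\<lambda>t t'. decorate t = decorate t') G G'"
      by (auto simp: list_all2_conv_all_nth list_eq_iff_nth_eq)
    then have "list_all2 (=) F F'" "list_all2 (=) G G'"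
      by (auto elim!: list.rel_mono_strong dest: B.IH)
    then show ?case by (simp add: t' list.rel_eq)
  qed
qed

lemma decorate_in: "decorate t \<in> decorated_T"
proof (induction t)
  case (B F G)
  then show ?case
    using decorated_T.intros[of "map decorate F" "map decorate G"]
    by (auto simp: comp_def in_lists_conv_set)
qed

lemma bij_betw_decorate: "bij_betw decorate UNIV decorated_T"
  unfolding bij_betw_def
proof (intro conjI inj_decorate equalityI subsetI)
  fix d assume "d \<in> decorated_T"
  then show "d \<in> range decorate"
  proof (induction rule: decorated_T.induct)
    case (1 F G)
    then have "F \<in> lists (range decorate)" "G \<in> lists (range decorate)" by auto
    then obtain F' G' where "F = map decorate F'" "G = map decorate G'"
      unfolding lists_image by auto
    then have "Node (map (Pair L) F @ map (Pair R) G) = decorate (B F' G')" by simp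
    then show ?case by blast
  qed
qed (auto simp: decorate_in)

lemma leaves_pos [simp]: "0 < leaves t"
  by (induction t) auto

lemma subspace_free_op: "pm.subspace (free_op n :: (bterm \<Rightarrow>\<^sub>0 'k::field) set)"
proof (rule pm.subspaceI)
  fix p q :: "bterm \<Rightarrow>\<^sub>0 'k" and c
  assume p: "p \<in> free_op n"
  show "pm_scale c p \<in> free_op n"
    using p keys_pm_scale[of c p] by (auto simp: free_op_def)
  assume "q \<in> free_op n"
  then show "p + q \<in> free_op n"
    using p keys_add[of p q] by (auto simp: free_op_def)
qed (simp add: free_op_def)

lemma bvec_free_op [simp]: "bvec t \<in> free_op n \<longleftrightarrow> leaves t = n"
  by (simp add: free_op_def)

lemma bilin_ext_free_op:
  assumes "p \<in> free_op m" "q \<in> free_op n"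
  shows "bilin_ext (Op g) p q \<in> free_op (m + n)"
  using assms keys_bilin_ext[of "Op g" p q] by (auto simp: free_op_def)

abbreviation free_eval where
  "free_eval \<equiv> eval (\<lambda>g. bilin_ext (Op g))"

lemma list_all2_take_drop:
  assumes "list_all2 P xs ys"
  shows "list_all2 P (take k xs) (take k ys)" "list_all2 P (drop k xs) (drop k ys)"
  using assms by (simp_all add: list_all2_takeI list_all2_dropI)

lemma sum_list_take_drop: "sum_list (take k ms) + sum_list (drop k ms) = sum_list (ms :: nat list)"
  by (metis append_take_drop_id sum_list_append)

lemma free_eval_free_op:
  assumes "list_all2 (\<lambda>q m. q \<in> free_op m) qs ms" "length qs = leaves t"
  shows "free_eval t qs \<in> free_op (sum_list ms)"
  using assms
proof (induction t arbitrary: qs ms)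
  case Leaf
  then show ?case by (auto simp: length_Suc_conv list_all2_Cons1)
next
  case (Op g s t)
  note td = list_all2_take_drop[OF Op.prems(1), of "leaves s"]
  have "free_eval (Op g s t) qs \<in>
      free_op (sum_list (take (leaves s) ms) + sum_list (drop (leaves s) ms))"
    using Op.prems(2) by (simp add: bilin_ext_free_op Op.IH(1)[OF td(1)] Op.IH(2)[OF td(2)])
  then show ?case by (simp only: sum_list_take_drop)
qed

lemma free_comp_free_op:
  assumes "list_all2 (\<lambda>q m. q \<in> free_op m) qs ms" "p \<in> free_op (length qs)"
  shows "free_comp p qs \<in> free_op (sum_list ms)"
  unfolding free_comp_def free_act_def
proof (rule pm.lin_ext_mem[OF subspace_free_op])
  fix t assume "t \<in> Poly_Mapping.keys p"
  with assms show "free_eval t qs \<in> free_op (sum_list ms)"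
    by (intro free_eval_free_op) (auto simp: free_op_def)
qed

lemma free_comp_bvec:
  "length ts = leaves t \<Longrightarrow> free_comp (bvec t) (map bvec ts) = bvec (eval Op t ts)"
  unfolding free_comp_def free_act_def pm.lin_ext_bvec
proof (induction t arbitrary: ts)
  case Leaf
  then show ?case by (auto simp: length_Suc_conv)
next
  case (Op g s t)
  then show ?case by (simp add: take_map drop_map)
qed

lemma relator_free_op: "p \<in> relators \<Longrightarrow> p \<in> free_op 3"
  unfolding relators_def relator_def
  by (auto intro!: pm.subspace_diff[OF subspace_free_op])

lemma bg_ideal_free_op: "bg_ideal n p \<Longrightarrow> p \<in> free_op n"
proof (induction rule: bg_ideal.induct)
  case (ideal_zero n)
  show ?case by (simp add: free_op_def)
qed (auto intro: relator_free_op free_comp_free_op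
   pm.subspace_add[OF subspace_free_op] pm.subspace_scale[OF subspace_free_op])

lemma subspace_bg_ideal: "pm.subspace (Collect (bg_ideal n))"
  by (rule pm.subspaceI) (auto intro: bg_ideal.intros)

lemma bg_ideal_uminus: "bg_ideal n p \<Longrightarrow> bg_ideal n (- p)"
  using pm.subspace_neg[OF subspace_bg_ideal, of p n] by simp

lemma equiv_bg_rel: "equiv (free_op n) (bg_rel n)"
proof (rule equivI)
  show "bg_rel n \<subseteq> free_op n \<times> free_op n" by (auto simp: bg_rel_def)
  show "refl_on (free_op n) (bg_rel n)"
    by (auto simp: refl_on_def bg_rel_def intro: bg_ideal.intros)
  show "sym (bg_rel n)"
    by (rule symI) (auto simp: bg_rel_def dest: bg_ideal_uminus)
  show "trans (bg_rel n)"
    by (rule transI) (auto simp: bg_rel_def dest: ideal_add)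
qed

abbreviation bg_class :: "nat \<Rightarrow> (bterm \<Rightarrow>\<^sub>0 'k::field) \<Rightarrow> 'k bg" where
  "bg_class n p \<equiv> bg_rel n `` {p}"

lemma bg_class_eq_iff:
  "p \<in> free_op n \<Longrightarrow> q \<in> free_op n \<Longrightarrow> bg_class n p = bg_class n q \<longleftrightarrow> bg_ideal n (p - q)"
  using eq_equiv_class_iff[OF equiv_bg_rel, of p n q] by (auto simp: bg_rel_def)

lemma bg_class_self: "p \<in> free_op n \<Longrightarrow> p \<in> bg_class n p"
  by (rule equiv_class_self[OF equiv_bg_rel])

lemma bg_ideal_bilin_left:
  assumes "bg_ideal m p" "q \<in> free_op n"
  shows "bg_ideal (m + n) (bilin_ext (Op g) p q)"
  using ideal_comp_right[of "bvec (Op g Leaf Leaf)" "[p, q]" "[m, n]" 0]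
    assms bg_ideal_free_op[OF assms(1)]
  by (simp add: free_comp_def free_act_def numeral_2_eq_2)

lemma bg_ideal_bilin_right:
  assumes "p \<in> free_op m" "bg_ideal n q"
  shows "bg_ideal (m + n) (bilin_ext (Op g) p q)"
  using ideal_comp_right[of "bvec (Op g Leaf Leaf)" "[p, q]" "[m, n]" 1]
    assms bg_ideal_free_op[OF assms(2)]
  by (simp add: free_comp_def free_act_def numeral_2_eq_2)

lemma bg_ideal_bilin_diff:
  assumes "p \<in> free_op m" "p' \<in> free_op m" "q \<in> free_op n" "q' \<in> free_op n"
    "bg_ideal m (p - p')" "bg_ideal n (q - q')"
  shows "bg_ideal (m + n) (bilin_ext (Op g) p q - bilin_ext (Op g) p' q')"
proof -
  have "bilin_ext (Op g) p q - bilin_ext (Op g) p' q' =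
      bilin_ext (Op g) (p - p') q + bilin_ext (Op g) p' (q - q')"
    by (simp add: bilin_ext_diff_left bilin_ext_diff_right)
  then show ?thesis
    using assms by (simp add: ideal_add bg_ideal_bilin_left bg_ideal_bilin_right)
qed

lemma free_eval_cong:
  assumes "list_all2 (\<lambda>q m. q \<in> free_op m) qs ms" "list_all2 (\<lambda>q m. q \<in> free_op m) qs' ms"
    "length qs = leaves t" "\<And>i. i < length qs \<Longrightarrow> bg_ideal (ms ! i) (qs ! i - qs' ! i)"
  shows "bg_ideal (sum_list ms) (free_eval t qs - free_eval t qs')"
  using assms
proof (induction t arbitrary: qs qs' ms)
  case Leaf
  then show ?case by (auto simp: length_Suc_conv list_all2_Cons1 list_all2_Cons2)
next
  case (Op g s t)
  note l = list_all2_lengthD[OF Op.prems(1)] list_all2_lengthD[OF Op.prems(2)]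
  let ?k = "leaves s"
  note td = list_all2_take_drop[OF Op.prems(1), of ?k] list_all2_take_drop[OF Op.prems(2), of ?k]
  have "bg_ideal (sum_list (take ?k ms)) (free_eval s (take ?k qs) - free_eval s (take ?k qs'))"
    using Op.prems l by (intro Op.IH(1) td) auto
  moreover have "bg_ideal (sum_list (drop ?k ms))
      (free_eval t (drop ?k qs) - free_eval t (drop ?k qs'))"
    using Op.prems l by (intro Op.IH(2) td) auto
  ultimately have "bg_ideal (sum_list (take ?k ms) + sum_list (drop ?k ms))
      (free_eval (Op g s t) qs - free_eval (Op g s t) qs')"
    using Op.prems l td
    by (auto intro!: bg_ideal_bilin_diff free_eval_free_op)
  then show ?case by (simp only: sum_list_take_drop)
qed

lemma (in vector_space) lin_ext_fun_diff:
  "lin_ext scale (\<lambda>b. f b - g b) p = lin_ext scale f p - lin_ext scale g p"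
  by (simp add: lin_ext_def scale_right_diff_distrib sum_subtractf)

lemma free_comp_cong:
  assumes "list_all2 (\<lambda>q m. q \<in> free_op m) qs ms" "list_all2 (\<lambda>q m. q \<in> free_op m) qs' ms"
    "\<And>i. i < length qs \<Longrightarrow> bg_ideal (ms ! i) (qs ! i - qs' ! i)"
    "p \<in> free_op (length qs)" "p' \<in> free_op (length qs)" "bg_ideal (length qs) (p - p')"
  shows "bg_ideal (sum_list ms) (free_comp p qs - free_comp p' qs')"
proof -
  have "bg_ideal (sum_list ms) (free_comp (p - p') qs)"
    using assms by (intro ideal_comp_left)
  moreover have "lin_ext pm_scale (\<lambda>t. free_eval t qs - free_eval t qs') p' \<in>
      Collect (bg_ideal (sum_list ms))"
    using assms
    by (intro pm.lin_ext_mem subspace_bg_ideal) (auto intro!: free_eval_cong simp: free_op_def)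
  ultimately have "bg_ideal (sum_list ms) (free_comp (p - p') qs +
      lin_ext pm_scale (\<lambda>t. free_eval t qs - free_eval t qs') p')"
    by (intro ideal_add) auto
  then show ?thesis
    by (simp add: free_comp_def free_act_def pm.lin_ext_diff pm.lin_ext_fun_diff)
qed

lemma listset_iff: "xs \<in> listset As \<longleftrightarrow> list_all2 (\<in>) xs As"
  by (induction As arbitrary: xs) (auto simp: set_Cons_def list_all2_Cons2)

text \<open>The composition and the action of the quotient may be computed on representatives.\<close>

lemma bg_comp_class:
  assumes qs: "list_all2 (\<lambda>q m. q \<in> free_op m) qs ms" and p: "p \<in> free_op (length qs)"
  shows "bg_comp ms (bg_class (length qs) p) (map2 bg_class ms qs) =
    bg_class (sum_list ms) (free_comp p qs)"
proof -
  have "bg_class (sum_list ms) (free_comp p' qs') = bg_class (sum_list ms) (free_comp p qs)"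
    if p': "p' \<in> bg_class (length qs) p" and qs': "qs' \<in> listset (map2 bg_class ms qs)" for p' qs'
  proof -
    have l: "length ms = length qs" using list_all2_lengthD[OF qs] by simp
    from qs' l have l': "length qs' = length qs"
      and "\<And>i. i < length qs \<Longrightarrow> qs' ! i \<in> bg_class (ms ! i) (qs ! i)"
      by (auto simp: listset_iff list_all2_conv_all_nth)
    then have *: "list_all2 (\<lambda>q m. q \<in> free_op m) qs' ms"
      "\<And>i. i < length qs \<Longrightarrow> bg_ideal (ms ! i) (qs ! i - qs' ! i)"
      using l by (auto simp: list_all2_conv_all_nth bg_rel_def)
    have **: "p' \<in> free_op (length qs)" "bg_ideal (length qs) (p - p')"
      using p' by (auto simp: bg_rel_def)
    have "bg_ideal (sum_list ms) (free_comp p qs - free_comp p' qs')"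
      by (rule free_comp_cong[OF qs *(1) *(2) p **])
    then show ?thesis
      using free_comp_free_op[OF qs p] free_comp_free_op[OF *(1)] l' **
      by (subst eq_commute) (simp add: bg_class_eq_iff)
  qed
  moreover have "qs \<in> listset (map2 bg_class ms qs)"
    using qs by (auto simp: listset_iff list_all2_conv_all_nth bg_rel_def ideal_zero)
  ultimately show ?thesis
    unfolding bg_comp_def using bg_class_self[OF p] by blast
qed

fun splits :: "nat list \<Rightarrow> 'a list \<Rightarrow> 'a list list" where
  "splits [] xs = []"
| "splits (m # ms) xs = take m xs # splits ms (drop m xs)"

lemma length_splits [simp]: "length (splits ms xs) = length ms"
  by (induction ms arbitrary: xs) auto

lemma take_splits: "take k (splits ms xs) = splits (take k ms) (take (sum_list (take k ms)) xs)"
proof (induction ms arbitrary: k xs)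
  case (Cons m ms)
  then show ?case by (cases k) (auto simp: drop_take)
qed auto

lemma drop_splits: "drop k (splits ms xs) = splits (drop k ms) (drop (sum_list (take k ms)) xs)"
proof (induction ms arbitrary: k xs)
  case (Cons m ms)
  then show ?case by (cases k) (auto simp: add.commute)
qed auto

context bigraft_algebra
begin

lemma zero_left: "y \<in> A \<Longrightarrow> opr g 0 y = 0"
  using scale_left[of 0 y g 0] subspace_0[OF subspace_A] by simp

lemma zero_right: "x \<in> A \<Longrightarrow> opr g x 0 = 0"
  using scale_right[of x 0 g 0] subspace_0[OF subspace_A] by simp

lemma opr_sum_left:
  assumes "y \<in> A" "\<And>i. i \<in> I \<Longrightarrow> h i \<in> A"
  shows "opr g (\<Sum>i\<in>I. h i) y = (\<Sum>i\<in>I. opr g (h i) y)"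
  using assms(2)
  by (induction I rule: infinite_finite_induct)
    (simp_all add: zero_left add_left assms(1) subspace_sum[OF subspace_A])

lemma opr_sum_right:
  assumes "x \<in> A" "\<And>i. i \<in> I \<Longrightarrow> h i \<in> A"
  shows "opr g x (\<Sum>i\<in>I. h i) = (\<Sum>i\<in>I. opr g x (h i))"
  using assms(2)
  by (induction I rule: infinite_finite_induct)
    (simp_all add: zero_right add_right assms(1) subspace_sum[OF subspace_A])

lemma opr_lin_ext_left:
  assumes "y \<in> A" "\<And>b. b \<in> Poly_Mapping.keys p \<Longrightarrow> f b \<in> A"
  shows "opr g (lin_ext scale f p) y = lin_ext scale (\<lambda>b. opr g (f b) y) p"
  using assms by (simp add: lin_ext_def opr_sum_left scale_left subspace_scale[OF subspace_A])

lemma opr_lin_ext_right: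
  assumes "x \<in> A" "\<And>b. b \<in> Poly_Mapping.keys p \<Longrightarrow> f b \<in> A"
  shows "opr g x (lin_ext scale f p) = lin_ext scale (\<lambda>b. opr g x (f b)) p"
  using assms by (simp add: lin_ext_def opr_sum_right scale_right subspace_scale[OF subspace_A])

lemma eval_closed: "set xs \<subseteq> A \<Longrightarrow> length xs = leaves t \<Longrightarrow> eval opr t xs \<in> A"
proof (induction t arbitrary: xs)
  case Leaf
  then show ?case by (auto simp: length_Suc_conv)
next
  case (Op g s t)
  have "set (take (leaves s) xs) \<subseteq> A" "set (drop (leaves s) xs) \<subseteq> A"
    using Op.prems(1) set_take_subset set_drop_subset by fast+
  with Op show ?case by (simp add: closed)
qed

lemma act_closed:
  "p \<in> free_op (length xs) \<Longrightarrow> set xs \<subseteq> A \<Longrightarrow> free_act scale opr p xs \<in> A"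
  unfolding free_act_def
  by (intro lin_ext_mem subspace_A) (auto simp: free_op_def intro!: eval_closed)

lemma act_bilin:
  assumes "p \<in> free_op m" "q \<in> free_op n" "set xs \<subseteq> A" "length xs = m + n"
  shows "free_act scale opr (bilin_ext (Op g) p q) xs =
    opr g (free_act scale opr p (take m xs)) (free_act scale opr q (drop m xs))"
proof -
  let ?x = "take m xs" and ?y = "drop m xs"
  have x: "set ?x \<subseteq> A" "length ?x = m" and y: "set ?y \<subseteq> A" "length ?y = n"
    using assms(3,4) set_take_subset[of m xs] set_drop_subset[of m xs] by auto
  have ev: "eval opr s ?x \<in> A" "eval opr t ?y \<in> A"
    if "s \<in> Poly_Mapping.keys p" "t \<in> Poly_Mapping.keys q" for s t
    using assms(1,2) that x y by (auto simp: free_op_def intro!: eval_closed)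
  have ev1: "eval opr s ?x \<in> A" if "s \<in> Poly_Mapping.keys p" for s
    using assms(1) that x by (auto simp: free_op_def intro!: eval_closed)
  have ev2: "eval opr t ?y \<in> A" if "t \<in> Poly_Mapping.keys q" for t
    using assms(2) that y by (auto simp: free_op_def intro!: eval_closed)
  have "free_act scale opr (bilin_ext (Op g) p q) xs =
      lin_ext scale (\<lambda>s. lin_ext scale (\<lambda>t. eval opr (Op g s t) xs) q) p"
    unfolding free_act_def bilin_ext_def lin_ext_lin_ext lin_ext_bvec ..
  also have "\<dots> = lin_ext scale (\<lambda>s. lin_ext scale (\<lambda>t. opr g (eval opr s ?x) (eval opr t ?y)) q) p"
    using assms(1) by (intro lin_ext_cong) (auto simp: free_op_def)
  also have "\<dots> = lin_ext scale (\<lambda>s. opr g (eval opr s ?x) (free_act scale opr q ?y)) p"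
    using ev1 ev2 by (intro lin_ext_cong) (simp add: free_act_def opr_lin_ext_right)
  also have "\<dots> = opr g (free_act scale opr p ?x) (free_act scale opr q ?y)"
    unfolding free_act_def[of _ _ p]
    using assms(2) y ev1 by (intro opr_lin_ext_left[symmetric] act_closed) auto
  finally show ?thesis .
qed

lemma act_free_eval:
  assumes "list_all2 (\<lambda>q m. q \<in> free_op m) qs ms" "length qs = leaves t"
    "set xs \<subseteq> A" "length xs = sum_list ms"
  shows "free_act scale opr (free_eval t qs) xs =
    eval opr t (map2 (free_act scale opr) qs (splits ms xs))"
  using assms
proof (induction t arbitrary: qs ms xs)
  case Leaf
  then show ?case by (auto simp: length_Suc_conv list_all2_Cons1)
next
  case (Op g s t)
  let ?k = "leaves s"
  let ?j = "sum_list (take ?k ms)" and ?n = "sum_list (drop ?k ms)"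
  note td = list_all2_take_drop[OF Op.prems(1), of ?k]
  have jn: "?j + ?n = sum_list ms" by (rule sum_list_take_drop)
  have lk: "length (take ?k qs) = leaves s" "length (drop ?k qs) = leaves t"
    using Op.prems(2) by auto
  have x: "set (take ?j xs) \<subseteq> A" "length (take ?j xs) = ?j"
    and y: "set (drop ?j xs) \<subseteq> A" "length (drop ?j xs) = ?n"
    using Op.prems(3,4) jn set_take_subset[of ?j xs] set_drop_subset[of ?j xs] by auto
  have "free_act scale opr (free_eval (Op g s t) qs) xs =
      opr g (free_act scale opr (free_eval s (take ?k qs)) (take ?j xs))
        (free_act scale opr (free_eval t (drop ?k qs)) (drop ?j xs))"
    using act_bilin[OF free_eval_free_op[OF td(1) lk(1)] free_eval_free_op[OF td(2) lk(2)]
        Op.prems(3)] Op.prems(4) jn by simp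
  then show ?case
    unfolding Op.IH(1)[OF td(1) lk(1) x] Op.IH(2)[OF td(2) lk(2) y]
    by (simp add: take_map drop_map take_zip drop_zip take_splits drop_splits)
qed

lemma act_free_comp:
  assumes "list_all2 (\<lambda>q m. q \<in> free_op m) qs ms" "p \<in> free_op (length qs)"
    "set xs \<subseteq> A" "length xs = sum_list ms"
  shows "free_act scale opr (free_comp p qs) xs =
    free_act scale opr p (map2 (free_act scale opr) qs (splits ms xs))"
proof -
  have "free_act scale opr (free_comp p qs) xs =
      lin_ext scale (\<lambda>t. free_act scale opr (free_eval t qs) xs) p"
    unfolding free_comp_def free_act_def by (rule lin_ext_lin_ext)
  also have "\<dots> = free_act scale opr p (map2 (free_act scale opr) qs (splits ms xs))"
    unfolding free_act_def[of _ _ p] using assms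
    by (intro lin_ext_cong act_free_eval) (auto simp: free_op_def)
  finally show ?thesis .
qed

lemma map2_act_closed:
  assumes "list_all2 (\<lambda>q m. q \<in> free_op m) qs ms" "set xs \<subseteq> A" "length xs = sum_list ms"
  shows "set (map2 (free_act scale opr) qs (splits ms xs)) \<subseteq> A"
  using assms
proof (induction arbitrary: xs rule: list_all2_induct)
  case (Cons q qs m ms)
  have "set (take m xs) \<subseteq> A" "set (drop m xs) \<subseteq> A"
    using Cons.prems set_take_subset[of m xs] set_drop_subset[of m xs] by auto
  with Cons show ?case by (auto intro!: act_closed)
qed simp

lemma eval_eq_0:
  "set xs \<subseteq> A \<Longrightarrow> length xs = leaves t \<Longrightarrow> j < length xs \<Longrightarrow> xs ! j = 0 \<Longrightarrow> eval opr t xs = 0"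
proof (induction t arbitrary: xs j)
  case Leaf
  then show ?case by (auto simp: length_Suc_conv)
next
  case (Op g s t)
  let ?k = "leaves s"
  have x: "set (take ?k xs) \<subseteq> A" "length (take ?k xs) = ?k"
    and y: "set (drop ?k xs) \<subseteq> A" "length (drop ?k xs) = leaves t"
    using Op.prems set_take_subset[of ?k xs] set_drop_subset[of ?k xs] by auto
  show ?case
  proof (cases "j < ?k")
    case True
    then have "eval opr s (take ?k xs) = 0"
      using Op.IH(1)[OF x, of j] Op.prems by simp
    then show ?thesis using eval_closed[OF y] by (simp add: zero_left)
  next
    case False
    then have "eval opr t (drop ?k xs) = 0"
      using Op.IH(2)[OF y, of "j - ?k"] Op.prems by simp
    then show ?thesis using eval_closed[OF x] by (simp add: zero_right)
  qed
qed

lemma act_relator: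
  assumes "p \<in> relators" "length xs = 3" "set xs \<subseteq> A"
  shows "free_act scale opr p xs = 0"
proof -
  obtain x y z where xs: "xs = [x, y, z]"
    using assms(2) by (auto simp: numeral_3_eq_3 length_Suc_conv)
  then have "x \<in> A" "y \<in> A" "z \<in> A" using assms(3) by auto
  then show ?thesis
    using assms(1) unfolding relators_def relator_def free_act_def xs
    by (auto simp: lin_ext_diff ast_ast ast_succ succ_ast prec_prec ast_prec succ_prec)
qed

lemma act_ideal:
  "bg_ideal n p \<Longrightarrow> length xs = n \<Longrightarrow> set xs \<subseteq> A \<Longrightarrow> free_act scale opr p xs = 0"
proof (induction arbitrary: xs rule: bg_ideal.induct)
  case (ideal_rel p)
  then show ?case by (simp add: act_relator)
next
  case (ideal_comp_left qs p ms)
  have "free_act scale opr (free_comp p qs) xs =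
      free_act scale opr p (map2 (free_act scale opr) qs (splits ms xs))"
    using ideal_comp_left by (intro act_free_comp bg_ideal_free_op)
  also have "\<dots> = 0"
    using ideal_comp_left.prems list_all2_lengthD[OF ideal_comp_left.hyps(2)]
    by (intro ideal_comp_left.IH map2_act_closed[OF ideal_comp_left.hyps(2)]) auto
  finally show ?case .
next
  case (ideal_comp_right p qs ms j)
  let ?ys = "map2 (free_act scale opr) qs (splits ms xs)"
  have l: "length ms = length qs" using list_all2_lengthD[OF ideal_comp_right.hyps(2)] by simp
  have A: "set ?ys \<subseteq> A"
    using ideal_comp_right by (intro map2_act_closed)
  have "length (splits ms xs ! j) = ms ! j \<and> set (splits ms xs ! j) \<subseteq> A"
    using ideal_comp_right.prems ideal_comp_right.hyps(3) unfolding l[symmetric]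
  proof (induction ms arbitrary: xs j)
    case (Cons m ms)
    have "set (take m xs) \<subseteq> A" "set (drop m xs) \<subseteq> A"
      using Cons.prems set_take_subset[of m xs] set_drop_subset[of m xs] by auto
    with Cons show ?case by (cases j) auto
  qed simp
  then have "?ys ! j = 0"
    using ideal_comp_right.IH ideal_comp_right.hyps(3) l by simp
  then have "eval opr t ?ys = 0" if "t \<in> Poly_Mapping.keys p" for t
    using that ideal_comp_right.hyps(1,3) A l by (intro eval_eq_0[of _ _ j]) (auto simp: free_op_def)
  then have "free_act scale opr p ?ys = 0"
    by (simp add: free_act_def lin_ext_def)
  then show ?case
    using act_free_comp[OF ideal_comp_right.hyps(2,1)] ideal_comp_right.prems by simp
qed (simp_all add: free_act_def lin_ext_add lin_ext_scale)

lemma bg_act_class: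
  assumes "p \<in> free_op (length xs)" "set xs \<subseteq> A"
  shows "bg_act scale opr (bg_class (length xs) p) xs = free_act scale opr p xs"
proof -
  have "free_act scale opr q xs = free_act scale opr p xs" if "q \<in> bg_class (length xs) p" for q
    using that act_ideal[of "length xs" "p - q" xs] assms
    by (simp add: bg_rel_def free_act_def lin_ext_diff)
  moreover have "bg_class (length xs) p \<noteq> {}"
    using bg_class_self[OF assms(1)] by fast
  ultimately show ?thesis
    unfolding bg_act_def by (metis (no_types, lifting) the_elem_image_unique)
qed

end

fun comb :: "bterm list \<Rightarrow> bterm" where
  "comb [] = Leaf"
| "comb [t] = t"
| "comb (t # ts) = Op Ast t (comb ts)"

fun tree_term :: "tree \<Rightarrow> bterm" where
  "tree_term (B F G) =
     (let b = (if F = [] then Leaf else Op Succ (comb (map tree_term F)) Leaf)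
      in if G = [] then b else Op Prec b (comb (map tree_term G)))"

definition forest_term :: "forest \<Rightarrow> bterm" where
  "forest_term F = comb (map tree_term F)"

definition vertex_term :: "forest \<Rightarrow> bterm" where
  "vertex_term F = (if F = [] then Leaf else Op Succ (forest_term F) Leaf)"

lemma tree_term_eq:
  "tree_term (B F G) =
     (if G = [] then vertex_term F else Op Prec (vertex_term F) (forest_term G))"
  by (simp add: forest_term_def vertex_term_def)

declare tree_term.simps [simp del]

lemma forest_term_single: "forest_term [t] = tree_term t"
  by (simp add: forest_term_def)

lemma forest_term_Cons: "F \<noteq> [] \<Longrightarrow> forest_term (t # F) = Op Ast (tree_term t) (forest_term F)"
  by (cases F) (simp_all add: forest_term_def)

lemma degree_Nil [simp]: "degree [] = 0"
  and degree_Cons [simp]: "degree (t # F) = vertices t + degree F"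
  and degree_append [simp]: "degree (F @ G) = degree F + degree G"
  by (simp_all add: degree_def)

lemma vertices_B [simp]: "vertices (B F G) = Suc (degree F + degree G)"
  by (simp add: degree_def)

declare vertices.simps [simp del]

lemma degree_forest_succ: "F \<noteq> [] \<Longrightarrow> degree (forest_succ G F) = degree G + degree F"
  by (cases F rule: list.exhaust; cases "hd F") auto

lemma degree_forest_prec: "G \<noteq> [] \<Longrightarrow> degree (forest_prec G F) = degree G + degree F"
  by (cases G rule: rev_exhaust; cases "last G") auto

lemma degree_forest_opr:
  "F \<noteq> [] \<Longrightarrow> G \<noteq> [] \<Longrightarrow> degree (forest_opr g F G) = degree F + degree G"
  by (cases g) (simp_all add: degree_forest_succ degree_forest_prec)

lemma forest_term_induct [consumes 1, case_names single Cons]: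
  assumes "F \<noteq> []" "\<And>t. P [t]" "\<And>t F. F \<noteq> [] \<Longrightarrow> P F \<Longrightarrow> P (t # F)"
  shows "P F"
  using assms by (induction F rule: list_nonempty_induct) auto

lemma leaves_forest_term_aux:
  "F \<noteq> [] \<Longrightarrow> (\<And>t. t \<in> set F \<Longrightarrow> leaves (tree_term t) = vertices t) \<Longrightarrow>
     leaves (forest_term F) = degree F"
  by (induction F rule: forest_term_induct) (auto simp: forest_term_single forest_term_Cons)

lemma leaves_tree_term [simp]: "leaves (tree_term t) = vertices t"
  by (induction t) (auto simp: tree_term_eq vertex_term_def leaves_forest_term_aux)

lemma leaves_forest_term [simp]: "F \<noteq> [] \<Longrightarrow> leaves (forest_term F) = degree F"
  by (simp add: leaves_forest_term_aux)

definition term_forest :: "bterm \<Rightarrow> forest" where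
  "term_forest t = eval forest_opr t (replicate (leaves t) [dot])"

lemma term_forest_Leaf [simp]: "term_forest Leaf = [dot]"
  by (simp add: term_forest_def)

lemma term_forest_Op [simp]:
  "term_forest (Op g s t) = forest_opr g (term_forest s) (term_forest t)"
  by (simp add: term_forest_def)

lemma term_forest_nonempty [simp]: "term_forest t \<noteq> []"
  by (induction t) (simp_all add: forest_opr_Nil_iff)

lemma degree_term_forest [simp]: "degree (term_forest t) = leaves t"
  by (induction t) (simp_all add: degree_forest_opr)

lemma term_forest_forest_term_aux:
  "F \<noteq> [] \<Longrightarrow> (\<And>t. t \<in> set F \<Longrightarrow> term_forest (tree_term t) = [t]) \<Longrightarrow>
     term_forest (forest_term F) = F"
  by (induction F rule: forest_term_induct) (auto simp: forest_term_single forest_term_Cons)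

lemma term_forest_tree_term: "term_forest (tree_term t) = [t]"
  by (induction t)
    (auto simp: tree_term_eq vertex_term_def term_forest_forest_term_aux forest_prec_def)

lemma term_forest_forest_term: "F \<noteq> [] \<Longrightarrow> term_forest (forest_term F) = F"
  by (simp add: term_forest_forest_term_aux term_forest_tree_term)

lemma eval_M_opr_bvec:
  "length Fs = leaves t \<Longrightarrow> eval M_opr t (map bvec Fs) = bvec (eval forest_opr t Fs)"
proof (induction t arbitrary: Fs)
  case Leaf
  then show ?case by (auto simp: length_Suc_conv)
next
  case (Op g s t)
  then show ?case by (simp add: take_map drop_map M_opr_def)
qed

lemma eval_M_opr_dots:
  "leaves t = n \<Longrightarrow> eval M_opr t (replicate n (bvec [dot])) = bvec (term_forest t)"
  using eval_M_opr_bvec[of "replicate n [dot]" t] by (simp add: term_forest_def)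

definition term_class :: "bterm \<Rightarrow> 'k::field bg" where
  "term_class t = bg_class (leaves t) (bvec t)"

lemma term_class_eq_iff:
  "(term_class s :: 'k::field bg) = term_class t \<longleftrightarrow>
     leaves s = leaves t \<and> bg_ideal (leaves s) (bvec s - bvec t :: _ \<Rightarrow>\<^sub>0 'k)"
proof (cases "leaves s = leaves t")
  case True
  then show ?thesis by (simp add: term_class_def bg_class_eq_iff)
next
  case False
  have "bvec s \<in> (term_class s :: 'k bg)" by (simp add: term_class_def bg_rel_def ideal_zero)
  moreover have "bvec s \<notin> (term_class t :: 'k bg)"
    using False by (simp add: term_class_def bg_rel_def)
  ultimately show ?thesis using False by auto
qed

lemma term_class_cong:
  assumes "(term_class s :: 'k::field bg) = term_class s'" "(term_class t :: 'k bg) = term_class t'"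
  shows "(term_class (Op g s t) :: 'k bg) = term_class (Op g s' t')"
  using assms bg_ideal_bilin_diff[of "bvec s :: _ \<Rightarrow>\<^sub>0 'k" "leaves s" "bvec s'" "bvec t" "leaves t" "bvec t'" g]
  unfolding term_class_eq_iff by auto

lemma term_class_assoc:
  assumes "(relator g h g' h' :: _ \<Rightarrow>\<^sub>0 'k::field) \<in> relators"
  shows "(term_class (Op h (Op g a b) c) :: 'k bg) = term_class (Op g' a (Op h' b c))"
proof -
  have "bg_ideal (sum_list [leaves a, leaves b, leaves c])
      (free_comp (relator g h g' h' :: _ \<Rightarrow>\<^sub>0 'k) [bvec a, bvec b, bvec c])"
    using ideal_rel[OF assms] by (intro ideal_comp_left) (simp_all add: numeral_3_eq_3)
  also have "free_comp (relator g h g' h' :: _ \<Rightarrow>\<^sub>0 'k) [bvec a, bvec b, bvec c] =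
      bvec (Op h (Op g a b) c) - bvec (Op g' a (Op h' b c))"
    by (simp add: free_comp_def free_act_def relator_def pm.lin_ext_diff)
  finally show ?thesis by (simp add: term_class_eq_iff add.assoc)
qed

lemma term_class_rels:
  "(term_class (Op Ast (Op Ast a b) c) :: 'k::field bg) = term_class (Op Ast a (Op Ast b c))"
  "(term_class (Op Succ (Op Ast a b) c) :: 'k bg) = term_class (Op Succ a (Op Succ b c))"
  "(term_class (Op Ast (Op Succ a b) c) :: 'k bg) = term_class (Op Succ a (Op Ast b c))"
  "(term_class (Op Prec (Op Prec a b) c) :: 'k bg) = term_class (Op Prec a (Op Ast b c))"
  "(term_class (Op Prec (Op Ast a b) c) :: 'k bg) = term_class (Op Ast a (Op Prec b c))"
  "(term_class (Op Prec (Op Succ a b) c) :: 'k bg) = term_class (Op Succ a (Op Prec b c))"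
  by (rule term_class_assoc; simp add: relators_def)+

lemma term_class_ast:
  assumes "F \<noteq> []" "G \<noteq> []"
  shows "(term_class (Op Ast (forest_term F) (forest_term G)) :: 'k::field bg) =
    term_class (forest_term (F @ G))"
  using assms
proof (induction F rule: forest_term_induct)
  case (single t)
  then show ?case by (simp add: forest_term_single forest_term_Cons)
next
  case (Cons t F)
  then have "(term_class (Op Ast (forest_term (t # F)) (forest_term G)) :: 'k bg) =
      term_class (Op Ast (tree_term t) (Op Ast (forest_term F) (forest_term G)))"
    by (simp add: forest_term_Cons term_class_rels)
  also have "\<dots> = term_class (Op Ast (tree_term t) (forest_term (F @ G)))"
    by (rule term_class_cong[OF refl Cons.IH[OF Cons.prems]])
  finally show ?case using Cons by (simp add: forest_term_Cons)
qed

lemma term_class_succ_vertex: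
  assumes "H \<noteq> []"
  shows "(term_class (Op Succ (forest_term H) (vertex_term F)) :: 'k::field bg) =
    term_class (vertex_term (H @ F))"
proof (cases "F = []")
  case False
  have "(term_class (Op Succ (forest_term H) (vertex_term F)) :: 'k bg) =
      term_class (Op Succ (Op Ast (forest_term H) (forest_term F)) Leaf)"
    using False by (simp add: vertex_term_def term_class_rels)
  also have "\<dots> = term_class (Op Succ (forest_term (H @ F)) Leaf)"
    by (rule term_class_cong[OF term_class_ast[OF assms False] refl])
  finally show ?thesis using False by (simp add: vertex_term_def)
qed (use assms in \<open>simp add: vertex_term_def\<close>)

lemma term_class_succ_tree:
  assumes "H \<noteq> []"
  shows "(term_class (Op Succ (forest_term H) (tree_term (B F G))) :: 'k::field bg) =
    term_class (tree_term (B (H @ F) G))"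
proof (cases "G = []")
  case True
  then show ?thesis using term_class_succ_vertex[OF assms] by (simp add: tree_term_eq)
next
  case False
  then have "(term_class (Op Succ (forest_term H) (tree_term (B F G))) :: 'k bg) =
      term_class (Op Prec (Op Succ (forest_term H) (vertex_term F)) (forest_term G))"
    by (simp add: tree_term_eq term_class_rels)
  also have "\<dots> = term_class (Op Prec (vertex_term (H @ F)) (forest_term G))"
    by (rule term_class_cong[OF term_class_succ_vertex[OF assms] refl])
  finally show ?thesis using False by (simp add: tree_term_eq)
qed

lemma term_class_succ:
  assumes "H \<noteq> []" "F \<noteq> []"
  shows "(term_class (Op Succ (forest_term H) (forest_term F)) :: 'k::field bg) =
    term_class (forest_term (forest_succ H F))"
proof -
  obtain F1 F2 Fs where F: "F = B F1 F2 # Fs"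
    using assms(2) by (metis list.exhaust tree.exhaust)
  show ?thesis
  proof (cases "Fs = []")
    case True
    then show ?thesis using term_class_succ_tree[OF assms(1)] by (simp add: F forest_term_single)
  next
    case False
    then have "(term_class (Op Succ (forest_term H) (forest_term F)) :: 'k bg) =
        term_class (Op Ast (Op Succ (forest_term H) (tree_term (B F1 F2))) (forest_term Fs))"
      by (simp add: F forest_term_Cons term_class_rels)
    also have "\<dots> = term_class (Op Ast (tree_term (B (H @ F1) F2)) (forest_term Fs))"
      by (rule term_class_cong[OF term_class_succ_tree[OF assms(1)] refl])
    finally show ?thesis using False by (simp add: F forest_term_Cons)
  qed
qed

lemma term_class_prec_tree:
  assumes "H \<noteq> []"
  shows "(term_class (Op Prec (tree_term (B F G)) (forest_term H)) :: 'k::field bg) =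
    term_class (tree_term (B F (G @ H)))"
proof (cases "G = []")
  case True
  then show ?thesis using assms by (simp add: tree_term_eq)
next
  case False
  then have "(term_class (Op Prec (tree_term (B F G)) (forest_term H)) :: 'k bg) =
      term_class (Op Prec (vertex_term F) (Op Ast (forest_term G) (forest_term H)))"
    by (simp add: tree_term_eq term_class_rels)
  also have "\<dots> = term_class (Op Prec (vertex_term F) (forest_term (G @ H)))"
    by (rule term_class_cong[OF refl term_class_ast[OF False assms]])
  finally show ?thesis using False by (simp add: tree_term_eq)
qed

lemma term_class_prec:
  assumes "F \<noteq> []" "H \<noteq> []"
  shows "(term_class (Op Prec (forest_term F) (forest_term H)) :: 'k::field bg) =
    term_class (forest_term (forest_prec F H))"
  using assms(1)
proof (induction F rule: forest_term_induct)
  case (single t)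
  then show ?case
    using term_class_prec_tree[OF assms(2)]
    by (cases t) (simp add: forest_term_single forest_prec_def)
next
  case (Cons t F)
  have "(term_class (Op Prec (forest_term (t # F)) (forest_term H)) :: 'k bg) =
      term_class (Op Ast (tree_term t) (Op Prec (forest_term F) (forest_term H)))"
    using Cons by (simp add: forest_term_Cons term_class_rels)
  also have "\<dots> = term_class (Op Ast (tree_term t) (forest_term (forest_prec F H)))"
    by (rule term_class_cong[OF refl Cons.IH])
  finally show ?case
    using Cons forest_prec_append[of F "[t]" H] by (simp add: forest_term_Cons forest_prec_def)
qed

lemma term_class_term_forest:
  "(term_class (forest_term (term_forest t)) :: 'k::field bg) = term_class t"
proof (induction t)
  case Leaf
  show ?case by (simp add: forest_term_single tree_term_eq vertex_term_def)
next
  case (Op g s t)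
  have "(term_class (Op g (forest_term (term_forest s)) (forest_term (term_forest t))) :: 'k bg) =
      term_class (forest_term (forest_opr g (term_forest s) (term_forest t)))"
    by (cases g) (simp_all add: term_class_ast term_class_succ term_class_prec)
  then show ?case using term_class_cong[OF Op.IH, of g] by simp
qed

definition M_section :: "(forest \<Rightarrow>\<^sub>0 'k::field) \<Rightarrow> (bterm \<Rightarrow>\<^sub>0 'k)" where
  "M_section = lin_ext pm_scale (\<lambda>F. bvec (forest_term F))"

lemma Psi_class:
  assumes "p \<in> free_op n"
  shows "Psi n (bg_class n p) = lin_ext pm_scale (\<lambda>t. bvec (term_forest t)) p"
proof -
  have "Psi n (bg_class n p) = free_act pm_scale M_opr p (replicate n (bvec [dot]))"
    using M.bg_act_class[of p "replicate n (bvec [dot])"] assms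
    by (simp add: Psi_def M_space_def set_replicate_conv_if)
  also have "\<dots> = lin_ext pm_scale (\<lambda>t. bvec (term_forest t)) p"
    unfolding free_act_def using assms
    by (intro pm.lin_ext_cong eval_M_opr_dots) (simp add: free_op_def)
  finally show ?thesis .
qed

lemma M_section_Psi:
  assumes "p \<in> free_op n"
  shows "bg_ideal n (p - M_section (Psi n (bg_class n p)))"
proof -
  have "p - M_section (Psi n (bg_class n p)) =
      lin_ext pm_scale bvec p - lin_ext pm_scale (\<lambda>t. bvec (forest_term (term_forest t))) p"
    using assms by (simp add: Psi_class M_section_def pm.lin_ext_lin_ext lin_ext_bvec_id)
  also have "\<dots> = lin_ext pm_scale (\<lambda>t. bvec t - bvec (forest_term (term_forest t))) p"
    by (rule pm.lin_ext_fun_diff[symmetric])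
  also have "\<dots> \<in> Collect (bg_ideal n)"
  proof (rule pm.lin_ext_mem[OF subspace_bg_ideal])
    fix t assume "t \<in> Poly_Mapping.keys p"
    then have "leaves t = n" using assms by (simp add: free_op_def)
    then show "bvec t - bvec (forest_term (term_forest t)) \<in> Collect (bg_ideal n)"
      using term_class_term_forest[of t, symmetric] unfolding term_class_eq_iff by simp
  qed
  finally show ?thesis by simp
qed

lemma M_section_free_op: "v \<in> M_degree n \<Longrightarrow> M_section v \<in> free_op n"
  unfolding M_section_def
proof (rule pm.lin_ext_mem[OF subspace_free_op])
  fix F assume "v \<in> M_degree n" "F \<in> Poly_Mapping.keys v"
  then have "F \<noteq> []" "degree F = n" by (auto simp: M_degree_def M_space_def)
  then show "bvec (forest_term F) \<in> free_op n" by simp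
qed

lemma Psi_M_section:
  assumes "v \<in> M_degree n"
  shows "Psi n (bg_class n (M_section v)) = v"
proof -
  have "Psi n (bg_class n (M_section v)) =
      lin_ext pm_scale (\<lambda>F. bvec (term_forest (forest_term F))) v"
    using M_section_free_op[OF assms]
    by (simp add: Psi_class) (simp add: M_section_def pm.lin_ext_lin_ext)
  also have "\<dots> = lin_ext pm_scale bvec v"
  proof (rule pm.lin_ext_cong)
    fix F assume "F \<in> Poly_Mapping.keys v"
    then have "F \<noteq> []" using assms by (auto simp: M_degree_def M_space_def)
    then show "bvec (term_forest (forest_term F)) = bvec F" by (simp add: term_forest_forest_term)
  qed
  finally show ?thesis by (simp add: lin_ext_bvec_id)
qed

lemma Psi_M_degree:
  assumes "p \<in> free_op n"
  shows "Psi n (bg_class n p) \<in> M_degree n"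
proof -
  let ?v = "lin_ext pm_scale (\<lambda>t. bvec (term_forest t)) p"
  have "F \<noteq> [] \<and> degree F = n" if "F \<in> Poly_Mapping.keys ?v" for F
  proof -
    from subsetD[OF keys_lin_ext that] obtain t
      where "t \<in> Poly_Mapping.keys p" "F = term_forest t" by (auto split: if_splits)
    then show ?thesis using assms by (simp add: free_op_def)
  qed
  then show ?thesis by (auto simp: Psi_class[OF assms] M_degree_def M_space_def)
qed

lemma bij_betw_Psi: "bij_betw (Psi n) (BG n) (M_degree n :: (forest \<Rightarrow>\<^sub>0 'k::field) set)"
proof (rule bij_betw_byWitness[where f' = "\<lambda>v. bg_class n (M_section v)"])
  show "Psi n ` BG n \<subseteq> (M_degree n :: (forest \<Rightarrow>\<^sub>0 'k) set)"
    by (auto simp: BG_def Psi_M_degree elim!: quotientE)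
  show "(\<lambda>v. bg_class n (M_section v)) ` (M_degree n :: (forest \<Rightarrow>\<^sub>0 'k) set) \<subseteq> BG n"
    by (auto simp: BG_def M_section_free_op intro: quotientI)
  show "\<forall>v\<in>(M_degree n :: (forest \<Rightarrow>\<^sub>0 'k) set). Psi n (bg_class n (M_section v)) = v"
    by (simp add: Psi_M_section)
  show "\<forall>P\<in>BG n :: 'k bg set. bg_class n (M_section (Psi n P)) = P"
  proof
    fix P :: "'k bg" assume "P \<in> BG n"
    then obtain p where p: "p \<in> free_op n" "P = bg_class n p"
      by (auto simp: BG_def elim!: quotientE)
    have "bg_class n p = bg_class n (M_section (Psi n (bg_class n p)))"
      using M_section_Psi[OF p(1)] M_section_free_op[OF Psi_M_degree[OF p(1)]] p(1)
      by (simp add: bg_class_eq_iff)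
    then show "bg_class n (M_section (Psi n P)) = P" using p(2) by simp
  qed
qed

end

theory Submission
  imports Defs
begin

text \<open>The identification \<open>\<Psi>\<close> sends an operation \<open>p\<close> to \<open>p.(\<bullet>, \<dots>, \<bullet>)\<close>, and the action of an
  operad on an algebra is compatible with composition. Hence, since \<open>\<Psi>\<close> turns the operation
  \<open>H\<^sub>i\<close> back into the forest \<open>H\<^sub>i\<close>, the composition \<open>F \<circ> (H\<^sub>1, \<dots>, H\<^sub>n)\<close> is just the value of the
  operation \<open>F\<close> on the elements \<open>H\<^sub>1, \<dots>, H\<^sub>n\<close> of the algebra \<open>\<M>\<close> (\<open>forest_comp_eq_eval\<close>).
  So it suffices to know one term in the generators that represents the operation \<open>F\<close>, and
  \<open>forest_term F\<close> is one: it writes a forest as the iterated \<open>\<star>\<close>-product of its trees, and a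
  tree as \<open>B F G = (F \<succ> \<bullet>) \<prec> G\<close>, where a factor is dropped if it is the empty forest.

  The rule for \<open>B F G\<close> is then the evaluation of this term, with the middle leaf receiving the
  argument \<open>H\<close>. For the rule for \<open>F @ G\<close> the bracketing of the \<open>\<star>\<close>-product has to be changed,
  which is allowed by associativity. Finally the rules determine the composition because every
  nonempty forest is a single tree or a product of shorter forests, so that one of the last two
  rules reduces its compositions to those of forests of smaller degree.\<close>

text \<open>By injectivity of \<open>\<Psi>\<close> it is enough that \<open>forest_term F\<close> evaluates to \<open>F\<close> at \<open>\<bullet>\<close>. This
  replaces the inverse of \<open>\<Psi>\<close> by an explicit representative.\<close>

lemma bg_of_forest_eq_term_class:
  assumes "F \<noteq> []"
  shows "(bg_of_forest F :: 'k::field bg) = term_class (forest_term F)"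
proof -
  let ?n = "degree F" and ?p = "bvec (forest_term F) :: bterm \<Rightarrow>\<^sub>0 'k"
  have p: "?p \<in> free_op ?n" using assms by simp
  then have "bg_class ?n ?p \<in> BG ?n" by (auto simp: BG_def intro: quotientI)
  moreover have "Psi ?n (bg_class ?n ?p) = bvec F"
    using assms by (simp add: Psi_class[OF p] term_forest_forest_term)
  ultimately have "bg_of_forest F = bg_class ?n ?p"
    unfolding bg_of_forest_def
    using bij_betw_imp_inj_on[OF bij_betw_Psi] by (metis inv_into_f_f)
  then show ?thesis using assms by (simp add: term_class_def)
qed

text \<open>The compatibility of action and composition: acting on copies of \<open>\<bullet>\<close> with a composite
  amounts to acting with the inner operations first and with the outer one on the results.\<close>

lemma term_forest_eval_Op:
  "length ts = leaves t \<Longrightarrow> term_forest (eval Op t ts) = eval forest_opr t (map term_forest ts)"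
proof (induction t arbitrary: ts)
  case Leaf
  then show ?case by (auto simp: length_Suc_conv)
next
  case (Op g s t)
  then show ?case by (simp add: take_map drop_map)
qed

text \<open>No inverse of \<open>\<Psi>\<close> and no quotient is left on the right-hand side, so that the rules for the
  composition become computations in \<open>\<M>\<close>.\<close>

lemma forest_comp_eq_eval:
  assumes "F \<noteq> []" "[] \<notin> set Hs" "length Hs = degree F"
  shows "(forest_comp F Hs :: forest \<Rightarrow>\<^sub>0 'k::field) =
    eval M_opr (forest_term F) (map bvec Hs)"
proof -
  let ?ms = "map degree Hs" and ?ts = "map forest_term Hs"
    and ?qs = "map (\<lambda>H. bvec (forest_term H) :: bterm \<Rightarrow>\<^sub>0 'k) Hs"
    and ?p = "bvec (forest_term F) :: bterm \<Rightarrow>\<^sub>0 'k"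
  have ne: "H \<noteq> []" if "H \<in> set Hs" for H using that assms(2) by auto
  have qs: "list_all2 (\<lambda>q m. q \<in> free_op m) ?qs ?ms"
    by (auto simp: list_all2_conv_all_nth ne)
  have p: "?p \<in> free_op (length ?qs)" using assms by simp
  have "map bg_of_forest Hs = map2 bg_class ?ms ?qs"
    by (intro nth_equalityI) (simp_all add: ne bg_of_forest_eq_term_class term_class_def)
  then have "bg_comp ?ms (bg_of_forest F) (map bg_of_forest Hs) =
      bg_class (sum_list ?ms) (free_comp ?p ?qs)"
    using bg_comp_class[OF qs p] assms
    by (simp add: bg_of_forest_eq_term_class term_class_def)
  then have "forest_comp F Hs = Psi (sum_list ?ms) (bg_class (sum_list ?ms) (free_comp ?p ?qs))"
    using assms(1) by (simp add: forest_comp_def)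
  also have "\<dots> = lin_ext pm_scale (\<lambda>t. bvec (term_forest t)) (free_comp ?p ?qs)"
    by (rule Psi_class[OF free_comp_free_op[OF qs p]])
  also have "free_comp ?p ?qs = bvec (eval Op (forest_term F) ?ts)"
    using free_comp_bvec[of ?ts "forest_term F"] assms by (simp add: comp_def)
  also have "map term_forest ?ts = Hs"
    by (simp add: map_idI ne term_forest_forest_term)
  then have "lin_ext pm_scale (\<lambda>t. bvec (term_forest t)) (bvec (eval Op (forest_term F) ?ts)) =
      (bvec (eval forest_opr (forest_term F) Hs) :: forest \<Rightarrow>\<^sub>0 'k)"
    using assms by (simp add: term_forest_eval_Op del: map_map)
  also have "\<dots> = eval M_opr (forest_term F) (map bvec Hs)"
    using assms by (simp add: eval_M_opr_bvec)
  finally show ?thesis .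
qed

text \<open>\<open>forest_term\<close> brackets a product of trees to the right, so that appending \<open>G\<close> to a forest
  with several trees moves brackets.\<close>

lemma (in bigraft_algebra) eval_forest_term_append:
  assumes "F \<noteq> []" "G \<noteq> []" "set xs \<subseteq> A" "set ys \<subseteq> A" "length xs = degree F" "length ys = degree G"
  shows "eval opr (forest_term (F @ G)) (xs @ ys) =
    opr Ast (eval opr (forest_term F) xs) (eval opr (forest_term G) ys)"
  using assms(1,3,5)
proof (induction F arbitrary: xs rule: forest_term_induct)
  case (single t)
  then show ?case using assms(2) by (simp add: forest_term_single forest_term_Cons)
next
  case (Cons t F)
  define us vs where "us = take (vertices t) xs" and "vs = drop (vertices t) xs"
  have xs: "xs = us @ vs" by (simp add: us_def vs_def)
  have us: "length us = vertices t" "set us \<subseteq> A" and vs: "length vs = degree F" "set vs \<subseteq> A"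
    using Cons.prems set_take_subset[of "vertices t" xs] set_drop_subset[of "vertices t" xs]
    by (auto simp: us_def vs_def)
  have "eval opr (forest_term ((t # F) @ G)) (xs @ ys) =
      opr Ast (eval opr (tree_term t) us)
        (opr Ast (eval opr (forest_term F) vs) (eval opr (forest_term G) ys))"
    using us vs Cons.hyps Cons.IH by (simp add: xs forest_term_Cons)
  also have "\<dots> = opr Ast
      (opr Ast (eval opr (tree_term t) us) (eval opr (forest_term F) vs))
      (eval opr (forest_term G) ys)"
    using us vs Cons.hyps assms by (intro ast_ast[symmetric] eval_closed) auto
  finally show ?case using us Cons.hyps by (simp add: xs forest_term_Cons)
qed

lemma forest_comp_Nil [simp]: "forest_comp [] Hs = bvec []"
  by (simp add: forest_comp_def)

lemma forest_comp_dot: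
  assumes "H \<noteq> []"
  shows "(forest_comp [dot] [H] :: forest \<Rightarrow>\<^sub>0 'k::field) = bvec H"
  using assms by (simp add: forest_comp_eq_eval forest_term_single tree_term_eq vertex_term_def)

lemma forest_comp_append:
  assumes "F \<noteq> []" "G \<noteq> []" "[] \<notin> set Hs" "[] \<notin> set Ks" "length Hs = degree F" "length Ks = degree G"
  shows "(forest_comp (F @ G) (Hs @ Ks) :: forest \<Rightarrow>\<^sub>0 'k::field) =
    forest_comp F Hs \<star> forest_comp G Ks"
proof -
  have "set (map bvec Hs) \<subseteq> (M_space :: (forest \<Rightarrow>\<^sub>0 'k) set)"
    "set (map bvec Ks) \<subseteq> (M_space :: (forest \<Rightarrow>\<^sub>0 'k) set)"
    using assms by (auto simp: M_space_def)
  then show ?thesis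
    using assms by (simp add: forest_comp_eq_eval M.eval_forest_term_append)
qed

text \<open>The term of \<open>B F G\<close> omits \<open>F\<close> or \<open>G\<close> if it is empty, which has the same effect as
  the conventions for the empty forest.\<close>

lemma forest_comp_B:
  assumes "[] \<notin> set Hs" "H \<noteq> []" "[] \<notin> set Ks" "length Hs = degree F" "length Ks = degree G"
  shows "(forest_comp [B F G] (Hs @ [H] @ Ks) :: forest \<Rightarrow>\<^sub>0 'k::field) =
    (forest_comp F Hs \<succ> bvec H) \<prec> forest_comp G Ks"
proof -
  have vertex: "eval M_opr (vertex_term F) (map bvec (Hs @ [H])) =
      (forest_comp F Hs \<succ> bvec H :: forest \<Rightarrow>\<^sub>0 'k)"
    using assms by (cases "F = []") (simp_all add: vertex_term_def forest_comp_eq_eval M_conventions)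
  have leaves: "leaves (vertex_term F) = Suc (degree F)"
    by (simp add: vertex_term_def)
  have "forest_comp [B F G] (Hs @ [H] @ Ks) =
      (eval M_opr (tree_term (B F G)) (map bvec (Hs @ [H] @ Ks)) :: forest \<Rightarrow>\<^sub>0 'k)"
    using assms by (subst forest_comp_eq_eval) (auto simp: forest_term_single)
  also have "\<dots> = (forest_comp F Hs \<succ> bvec H) \<prec> forest_comp G Ks"
  proof (cases "G = []")
    case True
    then show ?thesis using vertex assms by (simp add: tree_term_eq M_conventions)
  next
    case False
    have "eval M_opr (tree_term (B F G)) (map bvec (Hs @ [H]) @ map bvec Ks) =
        (eval M_opr (vertex_term F) (map bvec (Hs @ [H])) \<prec>
          eval M_opr (forest_term G) (map bvec Ks) :: forest \<Rightarrow>\<^sub>0 'k)"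
      using False assms by (simp add: tree_term_eq leaves)
    then show ?thesis using False assms vertex by (simp add: forest_comp_eq_eval)
  qed
  finally show ?thesis .
qed

text \<open>A forest with several trees is a product of shorter forests, and \<open>B F G\<close> has one vertex
  more than \<open>F\<close> and \<open>G\<close> together. The value at the empty forest is needed as a start, since the
  rule for \<open>B F G\<close> refers to it when \<open>F\<close> or \<open>G\<close> is empty.\<close>

lemma forest_comp_unique:
  fixes c :: "forest \<Rightarrow> forest list \<Rightarrow> (forest \<Rightarrow>\<^sub>0 'k::field)"
  assumes Nil: "c [] [] = bvec []"
    and append: "\<And>F G Hs Ks. F \<noteq> [] \<Longrightarrow> G \<noteq> [] \<Longrightarrow> [] \<notin> set Hs \<Longrightarrow> [] \<notin> set Ks \<Longrightarrow>
      length Hs = degree F \<Longrightarrow> length Ks = degree G \<Longrightarrow> c (F @ G) (Hs @ Ks) = c F Hs \<star> c G Ks"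
    and B: "\<And>F G Hs H Ks. [] \<notin> set Hs \<Longrightarrow> H \<noteq> [] \<Longrightarrow> [] \<notin> set Ks \<Longrightarrow>
      length Hs = degree F \<Longrightarrow> length Ks = degree G \<Longrightarrow>
      c [B F G] (Hs @ [H] @ Ks) = (c F Hs \<succ> bvec H) \<prec> c G Ks"
    and Hs: "[] \<notin> set Hs" "length Hs = degree F"
  shows "c F Hs = forest_comp F Hs"
  using Hs
proof (induction "degree F" arbitrary: F Hs rule: less_induct)
  case less
  consider "F = []" | F1 F2 where "F = [B F1 F2]" | t F' where "F = [t] @ F'" "F' \<noteq> []"
    by (cases F rule: list.exhaust; cases "tl F"; cases "hd F") auto
  then show ?case
  proof cases
    case 1
    then show ?thesis using Nil less.prems by simp
  next
    case (2 F1 F2)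
    define Hs1 H Hs2 where "Hs1 = take (degree F1) Hs" and "H = Hs ! degree F1"
      and "Hs2 = drop (Suc (degree F1)) Hs"
    have Hs: "Hs = Hs1 @ [H] @ Hs2"
      using less.prems 2 by (simp add: Hs1_def H_def Hs2_def id_take_nth_drop)
    have l: "length Hs1 = degree F1" "length Hs2 = degree F2"
      using less.prems 2 by (simp_all add: Hs1_def Hs2_def)
    have ne: "[] \<notin> set Hs1" "H \<noteq> []" "[] \<notin> set Hs2" using less.prems(1) by (auto simp: Hs)
    have "c F1 Hs1 = forest_comp F1 Hs1" "c F2 Hs2 = forest_comp F2 Hs2"
      using 2 l ne by (auto intro!: less.hyps)
    then show ?thesis unfolding 2 Hs B[OF ne l] forest_comp_B[OF ne l] by simp
  next
    case (3 t F')
    define Hs1 Hs2 where "Hs1 = take (vertices t) Hs" and "Hs2 = drop (vertices t) Hs"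
    have Hs: "Hs = Hs1 @ Hs2" by (simp add: Hs1_def Hs2_def)
    have l: "length Hs1 = degree [t]" "length Hs2 = degree F'"
      using less.prems 3 by (simp_all add: Hs1_def Hs2_def)
    have ne: "[] \<notin> set Hs1" "[] \<notin> set Hs2" using less.prems(1) by (auto simp: Hs)
    have pos: "0 < vertices s" for s by (cases s) simp
    have "0 < degree F'" using 3(2) pos by (cases F') auto
    then have "c [t] Hs1 = forest_comp [t] Hs1" "c F' Hs2 = forest_comp F' Hs2"
      using 3 l ne pos by (auto intro!: less.hyps)
    then show ?thesis
      unfolding 3(1) Hs append[OF not_Cons_self2 3(2) ne l]
        forest_comp_append[OF not_Cons_self2 3(2) ne l] by simp
  qed
qed

theorem theorem38:
  shows
    "(\<forall>H. H \<noteq> [] \<longrightarrow> forest_comp [dot] [H] = (bvec H :: forest \<Rightarrow>\<^sub>0 'k::field)) \<and>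
     (\<forall>F G Hs Ks. F \<noteq> [] \<and> G \<noteq> [] \<and> [] \<notin> set Hs \<and> [] \<notin> set Ks \<and>
        length Hs = degree F \<and> length Ks = degree G \<longrightarrow>
        (forest_comp (F @ G) (Hs @ Ks) :: forest \<Rightarrow>\<^sub>0 'k) =
          forest_comp F Hs \<star> forest_comp G Ks) \<and>
     (\<forall>F G Hs H Ks. [] \<notin> set Hs \<and> H \<noteq> [] \<and> [] \<notin> set Ks \<and>
        length Hs = degree F \<and> length Ks = degree G \<longrightarrow>
        (forest_comp [B F G] (Hs @ [H] @ Ks) :: forest \<Rightarrow>\<^sub>0 'k) =
          (forest_comp F Hs \<succ> bvec H) \<prec> forest_comp G Ks) \<and>
     (\<forall>c :: forest \<Rightarrow> forest list \<Rightarrow> (forest \<Rightarrow>\<^sub>0 'k).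
        c [] [] = bvec [] \<and>
        (\<forall>H. H \<noteq> [] \<longrightarrow> c [dot] [H] = bvec H) \<and>
        (\<forall>F G Hs Ks. F \<noteq> [] \<and> G \<noteq> [] \<and> [] \<notin> set Hs \<and> [] \<notin> set Ks \<and>
           length Hs = degree F \<and> length Ks = degree G \<longrightarrow>
           c (F @ G) (Hs @ Ks) = c F Hs \<star> c G Ks) \<and>
        (\<forall>F G Hs H Ks. [] \<notin> set Hs \<and> H \<noteq> [] \<and> [] \<notin> set Ks \<and>
           length Hs = degree F \<and> length Ks = degree G \<longrightarrow>
           c [B F G] (Hs @ [H] @ Ks) = (c F Hs \<succ> bvec H) \<prec> c G Ks)
        \<longrightarrow> (\<forall>F Hs. F \<noteq> [] \<and> [] \<notin> set Hs \<and> length Hs = degree F \<longrightarrow>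
              c F Hs = forest_comp F Hs))"
proof (intro conjI allI impI; (elim conjE)?)
  fix c :: "forest \<Rightarrow> forest list \<Rightarrow> (forest \<Rightarrow>\<^sub>0 'k)" and F :: forest and Hs :: "forest list"
  assume "c [] [] = bvec []"
    and "\<forall>F G Hs Ks. F \<noteq> [] \<and> G \<noteq> [] \<and> [] \<notin> set Hs \<and> [] \<notin> set Ks \<and>
      length Hs = degree F \<and> length Ks = degree G \<longrightarrow> c (F @ G) (Hs @ Ks) = c F Hs \<star> c G Ks"
    and "\<forall>F G Hs H Ks. [] \<notin> set Hs \<and> H \<noteq> [] \<and> [] \<notin> set Ks \<and>
      length Hs = degree F \<and> length Ks = degree G \<longrightarrow>
      c [B F G] (Hs @ [H] @ Ks) = (c F Hs \<succ> bvec H) \<prec> c G Ks"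
    and "[] \<notin> set Hs" "length Hs = degree F"
  then show "c F Hs = forest_comp F Hs"
    by (intro forest_comp_unique[of c Hs F]) blast+
qed (simp_all only: forest_comp_dot forest_comp_append forest_comp_B not_False_eq_True)

end
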